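(* Let $E_1,\ldots,E_n$ be compact sets in $\mathbb{R}^d$ such that $\tau(E_i)\geq c>0$ for $1\leq i\leq n$. Then the arithmetic sum $\bigoplus_{i=1}^n E_i=E_1+\cdots+E_n$ has non-empty interior provided that $n>2^{11}c^{-3}+1$.
   Context: For $E_1,\ldots,E_n\subset\mathbb{R}^d$, the arithmetic sum is $\bigoplus_{i=1}^n E_i=E_1+\cdots+E_n=\{x_1+\cdots+x_n: x_i\in E_i \text{ for } 1\le i\le n\}$. For $x\in\mathbb{R}^d$ and $r>0$, $B(x,r)$ denotes the closed ball centred at $x$ of radius $r$. For $F\subset\mathbb{R}^d$, $\mathrm{diam}(F)$ and $\mathrm{conv}(F)$ denote the diameter and the convex hull of $F$, respectively. Thickness: for a compact set $E$ in $\mathbb{R}^d$, the thickness $\tau(E)$ of $E$ is the largest number $c\in[0,1]$ such that for each $x\in E$ and $0<r\leq \mathrm{diam}(E)$, there exists $y=y(x,r)\in\mathbb{R}^d$ satisfying $\mathrm{conv}(B(x,r)\cap E)\supset B(y,cr)$.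
   Formalization: Each E_i is additionally assumed to have positive diameter; a set with at most one point has thickness 1 by the literal definition, and the claim fails when, for example, every E_i = {0}. *)

theory Defs
  imports "HOL-Analysis.Analysis" "HOL-Library.Set_Algebras"
begin

text \<open>If \<open>E\<close> has at most one point then \<open>diameter E = 0\<close>, so the condition below is vacuous
  and \<open>thickness E = 1\<close>; statements about thick sets must exclude this case.\<close>

definition thick_at_least :: "'a::euclidean_space set \<Rightarrow> real \<Rightarrow> bool" where
  "thick_at_least E c \<longleftrightarrow>
     (\<forall>x\<in>E. \<forall>r. 0 < r \<and> r \<le> diameter E \<longrightarrow>
        (\<exists>y. cball y (c * r) \<subseteq> convex hull (cball x r \<inter> E)))"

definition thickness :: "'a::euclidean_space set \<Rightarrow> real" where
  "thickness E = (GREATEST c. c \<in> {0..1} \<and> thick_at_least E c)"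

text \<open>The greatest element exists whenever \<open>E\<close> is compact.\<close>

lemma thick_at_least_0: "thick_at_least E 0"
  unfolding thick_at_least_def
proof (intro ballI allI impI)
  fix x r assume "x \<in> E" "0 < r \<and> r \<le> diameter E"
  then have "x \<in> cball x r \<inter> E" by simp
  then have "x \<in> convex hull (cball x r \<inter> E)" by (rule hull_inc)
  then show "\<exists>y. cball y (0 * r) \<subseteq> convex hull (cball x r \<inter> E)"
    by (intro exI[of _ x]) simp
qed

lemma thick_at_least_limit:
  assumes "compact E" and lim: "f \<longlonglongrightarrow> c"
    and f: "\<And>n. 0 \<le> f n" "\<And>n. thick_at_least E (f n)"
  shows "thick_at_least E c"
  unfolding thick_at_least_def
proof (intro ballI allI impI)
  fix x r assume x: "x \<in> E" and r: "0 < r \<and> r \<le> diameter E"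
  define K where "K = convex hull (cball x r \<inter> E)"
  have K: "compact K"
    unfolding K_def using assms(1) by (intro compact_convex_hull compact_Int_closed closed_cball closed_Int_compact)
  have "\<forall>n. \<exists>y. cball y (f n * r) \<subseteq> K"
    using f(2) x r unfolding thick_at_least_def K_def by blast
  then obtain y where y: "\<And>n. cball (y n) (f n * r) \<subseteq> K" by metis
  have "y n \<in> K" for n
    using y[of n] f(1)[of n] r by (auto simp: subset_iff)
  then obtain l g where g: "strict_mono g" "(y \<circ> g) \<longlonglongrightarrow> l"
    using K unfolding compact_def by blast
  have fg: "(\<lambda>n. f (g n)) \<longlonglongrightarrow> c"
    using LIMSEQ_subseq_LIMSEQ[OF lim g(1)] by (simp add: o_def)
  have c0: "0 \<le> c" using lim f(1) by (intro LIMSEQ_le_const[OF lim]) auto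
  have "cball l (c * r) \<subseteq> K"
  proof
    fix z assume z: "z \<in> cball l (c * r)"
    show "z \<in> K"
    proof (cases "c = 0")
      case True
      then have "z = l" using z by simp
      then show ?thesis
        using closed_sequentially[OF compact_imp_closed[OF K], of "y \<circ> g" l] g \<open>\<And>n. y n \<in> K\<close>
        by auto
    next
      case False
      then have c: "c > 0" using c0 by simp
      define u where "u n = y (g n) + (f (g n) / c) *\<^sub>R (z - l)" for n
      have "u n \<in> K" for n
      proof -
        have "norm (z - l) \<le> c * r"
          using z by (simp add: dist_norm norm_minus_commute)
        then have "norm ((f (g n) / c) *\<^sub>R (z - l)) \<le> (f (g n) / c) * (c * r)"
          using f(1)[of "g n"] c unfolding norm_scaleR
          by (metis abs_of_nonneg divide_nonneg_pos mult_left_mono)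
        then have "u n \<in> cball (y (g n)) (f (g n) * r)"
          using c by (simp add: u_def dist_norm)
        then show ?thesis using y by blast
      qed
      moreover have "u \<longlonglongrightarrow> l + (c / c) *\<^sub>R (z - l)"
        unfolding u_def using g(2) c by (intro tendsto_intros fg) (auto simp: o_def)
      ultimately show ?thesis
        using closed_sequentially[OF compact_imp_closed[OF K], of u z] c by simp
    qed
  qed
  then show "\<exists>y. cball y (c * r) \<subseteq> convex hull (cball x r \<inter> E)"
    unfolding K_def by blast
qed

lemma thickness_greatest:
  assumes "compact E"
  shows "thickness E \<in> {0..1}" "thick_at_least E (thickness E)"
    "\<And>c. c \<in> {0..1} \<Longrightarrow> thick_at_least E c \<Longrightarrow> c \<le> thickness E"
proof -
  define A where "A = {c. c \<in> {0..1} \<and> thick_at_least E c}"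
  have "closed A"
    unfolding closed_sequential_limits
  proof (intro allI impI)
    fix f l assume a: "(\<forall>n. f n \<in> A) \<and> f \<longlonglongrightarrow> l"
    then have "l \<in> {0..1}"
      using closed_sequentially[of "{0..1::real}" f l] by (auto simp: A_def)
    moreover have "thick_at_least E l"
      by (rule thick_at_least_limit[OF assms, of f]) (use a in \<open>auto simp: A_def\<close>)
    ultimately show "l \<in> A" by (simp add: A_def)
  qed
  moreover have "bounded A"
    by (rule bounded_subset[of "{0..1}"]) (auto simp: A_def)
  ultimately have "compact A" by (simp add: compact_eq_bounded_closed)
  moreover have "A \<noteq> {}" using thick_at_least_0[of E] by (force simp: A_def)
  ultimately obtain m where m: "m \<in> A" "\<And>c. c \<in> A \<Longrightarrow> c \<le> m"
    using compact_attains_sup[of A] by blast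
  have "thickness E = m"
    unfolding thickness_def by (rule Greatest_equality) (use m in \<open>auto simp: A_def\<close>)
  with m show "thickness E \<in> {0..1}" "thick_at_least E (thickness E)"
    "\<And>c. c \<in> {0..1} \<Longrightarrow> thick_at_least E c \<Longrightarrow> c \<le> thickness E"
    by (auto simp: A_def)
qed

end

theory Submission imports Defs begin

text \<open>Let \<open>cball (y i) (c * r) \<subseteq> convex hull (cball (x i) r \<inter> E i)\<close> for \<open>M\<close> sets \<open>E i\<close>. A target within
  \<open>M * c * r\<close> of the sum of the \<open>y i\<close> is a sum of points \<open>p i\<close> of these hulls, and rounding the
  \<open>p i\<close> one after the other to points \<open>q i\<close> of \<open>E i\<close> costs at most \<open>sqrt M * r\<close> in any dimension,
  because the squared errors add. The next centres, taken near \<open>q i\<close> at a radius \<open>r'\<close>, cost a further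
  \<open>M * r'\<close>, which the sets themselves cannot correct at scale \<open>r'\<close> since \<open>c \<le> 1\<close>. So one uses \<open>m\<close>
  groups of \<open>M\<close> sets, at radii \<open>R / 2 ^ k, \<dots>, R / 2 ^ (k + m - 1)\<close>, and always moves the coarsest
  group to radius \<open>R / 2 ^ (k + m)\<close>: the error stays below \<open>M * c\<close> times the largest radius
  if \<open>16 / c\<^sup>2 \<le> M\<close> and \<open>4 / c \<le> 2 ^ m\<close>. Hence every point near the initial sum of centres is a limit
  of points of the compact sum set.\<close>

section \<open>Rounding points of convex hulls to points of the sets\<close>

text \<open>A linear functional on \<open>F\<close> takes somewhere a value at most its value at
  \<open>p\<close>. For the functional given by \<open>a\<close>, all that can then increase the
  squared norm is \<open>(norm (q - x))\<^sup>2\<close>, at most \<open>r\<^sup>2\<close>.\<close>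

lemma convex_hull_rounding:
  fixes F :: "'a::real_inner set"
  assumes p: "p \<in> convex hull F" and F: "F \<subseteq> cball x r"
  shows "\<exists>q\<in>F. (norm (s + (q - p)))\<^sup>2 \<le> (norm s)\<^sup>2 + r\<^sup>2"
proof -
  \<comment> \<open>Expanding around \<open>x\<close>, this vector collects every term linear in
    \<open>q\<close> beyond \<open>(norm (q - x))\<^sup>2\<close>.\<close>
  define a where "a = s - p + x"
  have "\<exists>q\<in>F. a \<bullet> q \<le> a \<bullet> p"
  proof (rule ccontr)
    assume "\<not> (\<exists>q\<in>F. a \<bullet> q \<le> a \<bullet> p)"
    then have "F \<subseteq> {q. a \<bullet> q > a \<bullet> p}" by auto
    then have "convex hull F \<subseteq> {q. a \<bullet> q > a \<bullet> p}"
      by (intro hull_minimal convex_halfspace_gt)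
    then show False using p by auto
  qed
  then obtain q where q: "q \<in> F" "a \<bullet> q \<le> a \<bullet> p" by blast
  have "norm (q - x) \<le> r"
    using q(1) F by (auto simp: dist_norm norm_minus_commute)
  then have "(norm (q - x))\<^sup>2 \<le> r\<^sup>2" by (intro power_mono) auto
  moreover have "(norm (s + (q - p)))\<^sup>2 =
      (norm s)\<^sup>2 + (norm (q - x))\<^sup>2 - (norm (p - x))\<^sup>2 + 2 * (a \<bullet> q - a \<bullet> p)"
    unfolding power2_norm_eq_inner a_def
    by (simp add: inner_simps inner_commute algebra_simps)
  moreover have "0 \<le> (norm (p - x))\<^sup>2" by simp
  ultimately have "(norm (s + (q - p)))\<^sup>2 \<le> (norm s)\<^sup>2 + r\<^sup>2" using q(2) by argo
  then show ?thesis using q(1) by blast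
qed

text \<open>The points are rounded one at a time, with the error accumulated so far as
  \<open>s\<close> in \<open>convex_hull_rounding\<close>.\<close>

lemma convex_hull_sum_rounding:
  fixes F :: "'i \<Rightarrow> 'a::real_inner set"
  assumes "finite A" "\<And>i. i \<in> A \<Longrightarrow> p i \<in> convex hull F i" "\<And>i. i \<in> A \<Longrightarrow> F i \<subseteq> cball (x i) r"
  shows "\<exists>q. (\<forall>i\<in>A. q i \<in> F i) \<and> (norm (\<Sum>i\<in>A. q i - p i))\<^sup>2 \<le> real (card A) * r\<^sup>2"
  using assms
proof (induction A)
  case empty
  then show ?case by simp
next
  case (insert a A)
  then obtain q where q: "\<forall>i\<in>A. q i \<in> F i" "(norm (\<Sum>i\<in>A. q i - p i))\<^sup>2 \<le> real (card A) * r\<^sup>2"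
    by auto
  obtain b where b: "b \<in> F a"
    "(norm ((\<Sum>i\<in>A. q i - p i) + (b - p a)))\<^sup>2 \<le> (norm (\<Sum>i\<in>A. q i - p i))\<^sup>2 + r\<^sup>2"
    using convex_hull_rounding[of "p a" "F a" "x a" r] insert.prems by blast
  have "(\<Sum>i\<in>insert a A. (q(a := b)) i - p i) = (\<Sum>i\<in>A. q i - p i) + (b - p a)"
  proof -
    have "(\<Sum>i\<in>A. (q(a := b)) i - p i) = (\<Sum>i\<in>A. q i - p i)"
      using insert.hyps by (intro sum.cong) auto
    then show ?thesis using insert.hyps by simp
  qed
  then have "(norm (\<Sum>i\<in>insert a A. (q(a := b)) i - p i))\<^sup>2 \<le> real (card (insert a A)) * r\<^sup>2"
    using b(2) q(2) insert.hyps by (simp add: algebra_simps)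
  moreover have "\<forall>i\<in>insert a A. (q(a := b)) i \<in> F i" using b q by auto
  ultimately show ?case by blast
qed

lemma thick_at_least_mono:
  assumes "thick_at_least E c" "c' \<le> c"
  shows "thick_at_least E c'"
  unfolding thick_at_least_def
proof (intro ballI allI impI)
  fix x r assume "x \<in> E" and r: "0 < r \<and> r \<le> diameter E"
  then obtain y where "cball y (c * r) \<subseteq> convex hull (cball x r \<inter> E)"
    using assms(1) unfolding thick_at_least_def by blast
  moreover have "cball y (c' * r) \<subseteq> cball y (c * r)"
    using assms(2) r by (intro subset_cball) simp
  ultimately show "\<exists>y. cball y (c' * r) \<subseteq> convex hull (cball x r \<inter> E)" by blast
qed

lemma compact_set_sum:
  fixes E :: "'i \<Rightarrow> 'a::real_normed_vector set"
  assumes "\<And>i. i \<in> I \<Longrightarrow> compact (E i)"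
  shows "compact (\<Sum>i\<in>I. E i)"
proof (cases "finite I")
  case True
  then show ?thesis
    using assms
  proof (induction I)
    case (insert i I)
    have "(\<Sum>j\<in>insert i I. E j) = {u + v | u v. u \<in> E i \<and> v \<in> (\<Sum>j\<in>I. E j)}"
      using insert.hyps by (auto simp: set_plus_def)
    then show ?case using insert by (simp add: compact_sums)
  qed simp
\<comment> \<open>Over an infinite index set the sum is by default \<open>0\<close>, the singleton
  of the origin.\<close>
qed simp

section \<open>The multiscale correction scheme\<close>

locale thick_family =
  fixes E :: "nat \<Rightarrow> 'a::euclidean_space set" and I :: "nat set" and c R :: real and M m :: nat
  assumes fin: "finite I"
    and R: "0 < R" "\<And>i. i \<in> I \<Longrightarrow> R \<le> diameter (E i)"
    and thick: "\<And>i. i \<in> I \<Longrightarrow> thick_at_least (E i) c"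
    and c: "0 < c"
    and M: "16 / c\<^sup>2 \<le> real M"
    and m: "4 / c \<le> 2 ^ m"
begin

definition rad :: "nat \<Rightarrow> real" where
  "rad k = R / 2 ^ k"

definition centred :: "(nat \<Rightarrow> nat) \<Rightarrow> (nat \<Rightarrow> 'a) \<Rightarrow> (nat \<Rightarrow> 'a) \<Rightarrow> bool" where
  "centred s x y \<longleftrightarrow>
     (\<forall>i\<in>I. x i \<in> E i \<and> cball (y i) (c * rad (s i)) \<subseteq> convex hull (cball (x i) (rad (s i)) \<inter> E i))"

text \<open>The window of scales starts at \<open>k\<close>, so passing to stage
  \<open>Suc k\<close> means moving just the group at scale \<open>k\<close>.\<close>

definition staged :: "nat \<Rightarrow> (nat \<Rightarrow> nat) \<Rightarrow> bool" where
  "staged k s \<longleftrightarrow> s ` I \<subseteq> {k..<k + m} \<and> (\<forall>t\<in>{k..<k + m}. card {i\<in>I. s i = t} = M)"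

lemma rad_pos: "0 < rad k"
  using R(1) by (simp add: rad_def)

lemma rad_antimono: "k \<le> l \<Longrightarrow> rad l \<le> rad k"
  using R(1) by (simp add: rad_def field_simps power_increasing)

lemma rad_le_diameter: "i \<in> I \<Longrightarrow> rad k \<le> diameter (E i)"
  using rad_antimono[of 0 k] R(2)[of i] by (simp add: rad_def)

lemma centre_exists:
  assumes "i \<in> I" "x \<in> E i"
  shows "\<exists>y. cball y (c * rad k) \<subseteq> convex hull (cball x (rad k) \<inter> E i)"
  using thick[OF assms(1)] assms rad_pos rad_le_diameter unfolding thick_at_least_def by blast

lemma centre_close:
  fixes x y :: 'a
  assumes "cball y (c * rad k) \<subseteq> convex hull (cball x (rad k) \<inter> E i)"
  shows "norm (x - y) \<le> rad k"
proof -
  have "y \<in> cball y (c * rad k)" using c rad_pos[of k] by simp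
  also note assms
  also have "convex hull (cball x (rad k) \<inter> E i) \<subseteq> cball x (rad k)"
    by (intro hull_minimal) auto
  finally show ?thesis by (simp add: dist_norm)
qed

lemma M_pos: "0 < M"
  using M c by (cases "M = 0") (auto simp: field_simps)

text \<open>The bound on \<open>M\<close> makes the rounding cost at most
  \<open>M * c / 4 * rad k\<close>, and the bound on \<open>m\<close> does the same for the
  recentring cost. Together they make half of the tolerance at scale \<open>k\<close>, which is the
  tolerance at scale \<open>Suc k\<close>.\<close>

lemma error_bound: "sqrt (real M) * rad k + real M * rad (k + m) \<le> real M * c * rad (Suc k)"
proof -
  have "(4 / c)\<^sup>2 \<le> real M" using M by (simp add: power_divide)
  then have "4 / c \<le> sqrt (real M)" using real_le_rsqrt by blast
  then have "4 \<le> c * sqrt (real M)" using c by (simp add: field_simps)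
  then have "sqrt (real M) * 4 \<le> sqrt (real M) * (c * sqrt (real M))"
    by (intro mult_left_mono) auto
  then have "sqrt (real M) \<le> real M * c / 4" by (simp add: algebra_simps)
  then have 1: "sqrt (real M) * rad k \<le> real M * c / 4 * rad k"
    using rad_pos[of k] by (intro mult_right_mono) auto
  have "1 / 2 ^ m \<le> c / 4" using m c by (simp add: field_simps)
  then have "real M * rad k * (1 / 2 ^ m) \<le> real M * rad k * (c / 4)"
    using rad_pos[of k] by (intro mult_left_mono) auto
  then have 2: "real M * rad (k + m) \<le> real M * c / 4 * rad k"
    by (simp add: rad_def power_add field_simps)
  have "real M * c * rad (Suc k) = real M * c / 4 * rad k + real M * c / 4 * rad k"
    by (simp add: rad_def field_simps)
  then show ?thesis using 1 2 by linarith
qed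

lemma staged_step:
  assumes "staged k s" "0 < m"
  shows "staged (Suc k) (\<lambda>i. if s i = k then k + m else s i)" (is "staged _ ?s")
  unfolding staged_def
proof (intro conjI ballI)
  have "s i \<in> {k..<k + m}" if "i \<in> I" for i using assms that unfolding staged_def by auto
  then have s: "k \<le> s i" "s i < k + m" if "i \<in> I" for i using that by auto
  show "?s ` I \<subseteq> {Suc k..<Suc k + m}"
    using s assms(2) by (auto simp: le_less_Suc_eq) (metis Suc_leI le_neq_implies_less less_Suc_eq)+
  fix t assume t: "t \<in> {Suc k..<Suc k + m}"
  show "card {i\<in>I. ?s i = t} = M"
  proof (cases "t = k + m")
    case True
    \<comment> \<open>The window is half-open, so no set had scale \<open>k + m\<close> before; the
      new group is exactly the old group at \<open>k\<close>.\<close>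
    then have "{i\<in>I. ?s i = t} = {i\<in>I. s i = k}" using s by (fastforce split: if_splits)
    then show ?thesis using assms unfolding staged_def by simp
  next
    case False
    then have "{i\<in>I. ?s i = t} = {i\<in>I. s i = t}" using t by (auto split: if_splits)
    then show ?thesis using assms False t unfolding staged_def by simp
  qed
qed

text \<open>The balls of the coarsest group are large enough to absorb the whole error; only
  rounding and recentring costs remain, and \<open>error_bound\<close> controls them.\<close>

lemma centred_step:
  assumes st: "staged k s" "0 < m" and cen: "centred s x y"
    and z: "norm (z - sum y I) \<le> real M * c * rad k"
  shows "\<exists>s x y. staged (Suc k) s \<and> centred s x y \<and> norm (z - sum y I) \<le> real M * c * rad (Suc k)"
proof -
  define A where "A = {i\<in>I. s i = k}"
  have A: "finite A" "A \<subseteq> I" "card A = M" using fin st by (auto simp: A_def staged_def)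
  define v where "v = z - sum y I"
  \<comment> \<open>Each of the \<open>M\<close> sets of the group takes an equal share of the
    error, small enough to stay in its ball.\<close>
  define p where "p i = y i + v /\<^sub>R real M" for i
  have "norm (v /\<^sub>R real M) \<le> c * rad k"
    using z M_pos by (simp add: v_def divide_inverse_commute[symmetric] pos_divide_le_eq mult_ac)
  then have "p i \<in> cball (y i) (c * rad k)" for i
    by (simp add: p_def dist_norm)
  then have "p i \<in> convex hull (cball (x i) (rad k) \<inter> E i)" if "i \<in> A" for i
    using cen that unfolding centred_def A_def by blast
  then obtain q where q: "\<forall>i\<in>A. q i \<in> cball (x i) (rad k) \<inter> E i"
      "(norm (\<Sum>i\<in>A. q i - p i))\<^sup>2 \<le> real M * (rad k)\<^sup>2"
    using convex_hull_sum_rounding[of A p "\<lambda>i. cball (x i) (rad k) \<inter> E i" x "rad k"] A by auto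
  have nq: "norm (\<Sum>i\<in>A. q i - p i) \<le> sqrt (real M) * rad k"
    using real_le_rsqrt[OF q(2)] rad_pos[of k] by (simp add: real_sqrt_mult)
  have "\<forall>i\<in>A. \<exists>u. cball u (c * rad (k + m)) \<subseteq> convex hull (cball (q i) (rad (k + m)) \<inter> E i)"
    using q(1) A(2) centre_exists by blast
  then obtain u where
    u: "\<forall>i\<in>A. cball (u i) (c * rad (k + m)) \<subseteq> convex hull (cball (q i) (rad (k + m)) \<inter> E i)"
    by metis
  have nu: "norm (\<Sum>i\<in>A. q i - u i) \<le> real M * rad (k + m)"
  proof -
    have "norm (q i - u i) \<le> rad (k + m)" if "i \<in> A" for i
      using u that centre_close by blast
    then show ?thesis using sum_norm_bound[of A "\<lambda>i. q i - u i"] A(3) by simp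
  qed
  define y' where "y' i = (if i \<in> A then u i else y i)" for i
  have "sum y I - sum y' I = (\<Sum>i\<in>I. if i \<in> A then y i - u i else 0)"
    unfolding sum_subtractf[symmetric] by (intro sum.cong) (auto simp: y'_def)
  also have "\<dots> = (\<Sum>i\<in>A. y i - u i)"
    using fin A(2) by (simp add: sum.inter_restrict[symmetric] Int_absorb1)
  finally have "z - sum y' I = v + (\<Sum>i\<in>A. y i - u i)" by (simp add: v_def algebra_simps)
  \<comment> \<open>The \<open>M\<close> shares add up to \<open>v\<close>, so the old error
    disappears here.\<close>
  also have "\<dots> = (\<Sum>i\<in>A. p i - u i)"
    using M_pos A(3) by (simp add: p_def sum.distrib sum_subtractf sum_constant_scaleR)
  also have "\<dots> = (\<Sum>i\<in>A. q i - u i) - (\<Sum>i\<in>A. q i - p i)"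
    by (simp add: sum_subtractf)
  finally have "norm (z - sum y' I) \<le> norm (\<Sum>i\<in>A. q i - u i) + norm (\<Sum>i\<in>A. q i - p i)"
    by (simp only: norm_triangle_ineq4)
  also have "\<dots> \<le> real M * c * rad (Suc k)"
    using nu nq error_bound[of k] by linarith
  finally have "norm (z - sum y' I) \<le> real M * c * rad (Suc k)" .
  moreover have "centred (\<lambda>i. if s i = k then k + m else s i) (\<lambda>i. if i \<in> A then q i else x i) y'"
    using cen u q(1) unfolding centred_def by (auto simp: A_def y'_def)
  ultimately show ?thesis using staged_step[OF st] by blast
qed

lemma cball_subset_set_sum:
  assumes st: "staged 0 s" and cen: "centred s x y" and comp: "\<And>i. i \<in> I \<Longrightarrow> compact (E i)"
    and "0 < m"
  shows "cball (sum y I) (real M * c * R) \<subseteq> (\<Sum>i\<in>I. E i)"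
proof
  fix z assume "z \<in> cball (sum y I) (real M * c * R)"
  then have z: "norm (z - sum y I) \<le> real M * c * rad 0"
    by (simp add: rad_def dist_norm norm_minus_commute)
  have inv: "\<exists>s x y. staged k s \<and> centred s x y \<and> norm (z - sum y I) \<le> real M * c * rad k" for k
  proof (induction k)
    case 0
    then show ?case using st cen z by blast
  next
    case (Suc k)
    then show ?case using centred_step \<open>0 < m\<close> by blast
  qed
  \<comment> \<open>\<open>M * c\<close> bounds the distance from the target to the sum of centres;
    \<open>card I\<close> accounts for replacing each \<open>y i\<close> by \<open>x i\<close>, at
    cost at most \<open>rad k\<close> since \<open>s i\<close> is at least \<open>k\<close>.\<close>
  define C where "C = real M * c + real (card I)"
  have approx: "\<exists>w\<in>(\<Sum>i\<in>I. E i). norm (w - z) \<le> C * rad k" for k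
  proof -
    obtain s x y where h: "staged k s" "centred s x y" "norm (z - sum y I) \<le> real M * c * rad k"
      using inv by blast
    have "norm (x i - y i) \<le> rad k" if "i \<in> I" for i
      using centre_close[of "y i" "s i" "x i" i] h(1,2) that rad_antimono[of k "s i"]
      unfolding centred_def staged_def by fastforce
    then have "norm (sum x I - sum y I) \<le> real (card I) * rad k"
      unfolding sum_subtractf[symmetric] by (intro sum_norm_bound)
    then have "norm (sum x I - z) \<le> C * rad k"
      using h(3) norm_triangle_ineq4[of "sum x I - sum y I" "z - sum y I"]
      by (simp add: C_def algebra_simps)
    moreover have "sum x I \<in> (\<Sum>i\<in>I. E i)"
      using h(2) fin by (auto simp: set_sum_alt centred_def)
    ultimately show ?thesis by blast
  qed
  then obtain w where w: "\<And>k. w k \<in> (\<Sum>i\<in>I. E i)" "\<And>k. norm (w k - z) \<le> C * rad k" by metis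
  have "(\<lambda>k. C * R * (1 / 2) ^ k) \<longlonglongrightarrow> C * R * 0"
    by (intro tendsto_intros LIMSEQ_power_zero) auto
  then have "(\<lambda>k. C * rad k) \<longlonglongrightarrow> 0" by (simp add: rad_def power_one_over)
  then have "w \<longlonglongrightarrow> z"
    by (intro LIM_zero_cancel[of w], rule Lim_null_comparison[rotated]) (use w(2) in auto)
  then show "z \<in> (\<Sum>i\<in>I. E i)"
    using closed_sequentially[of "\<Sum>i\<in>I. E i" w z] compact_imp_closed[OF compact_set_sum] comp w(1)
    by blast
qed

end

section \<open>Interior of the sum and the choice of group sizes\<close>

text \<open>Fixing one point in each extra set places a translate of the smaller sum inside the
  larger one.\<close>

lemma interior_set_sum_superset:
  fixes E :: "'i \<Rightarrow> 'a::real_normed_vector set"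
  assumes "finite J" "I \<subseteq> J" "\<And>i. i \<in> J \<Longrightarrow> E i \<noteq> {}" "interior (\<Sum>i\<in>I. E i) \<noteq> {}"
  shows "interior (\<Sum>i\<in>J. E i) \<noteq> {}"
proof -
  have "\<forall>i\<in>J. \<exists>e. e \<in> E i" using assms(3) by blast
  then obtain e where e: "\<forall>i\<in>J. e i \<in> E i" by metis
  have "sum e (J - I) \<in> (\<Sum>i\<in>J - I. E i)"
    using assms(1) e by (auto simp: set_sum_alt)
  moreover have "(\<Sum>i\<in>J. E i) = (\<Sum>i\<in>J - I. E i) + (\<Sum>i\<in>I. E i)"
    using assms by (intro sum.subset_diff)
  ultimately have "(+) (sum e (J - I)) ` (\<Sum>i\<in>I. E i) \<subseteq> (\<Sum>i\<in>J. E i)"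
    by (auto simp: set_plus_def)
  from interior_mono[OF this] show ?thesis
    using assms(4) by (auto simp: interior_translation)
qed

lemma interior_sum_thick_sets:
  fixes E :: "nat \<Rightarrow> 'a::euclidean_space set"
  assumes comp: "\<And>i. i \<in> {1..M * m} \<Longrightarrow> compact (E i)"
    and diam: "\<And>i. i \<in> {1..M * m} \<Longrightarrow> 0 < diameter (E i)"
    and thick: "\<And>i. i \<in> {1..M * m} \<Longrightarrow> thick_at_least (E i) c"
    and c: "0 < c" and M: "16 / c\<^sup>2 \<le> real M" and m: "4 / c \<le> 2 ^ m" "0 < m"
  shows "interior (\<Sum>i\<in>{1..M * m}. E i) \<noteq> {}"
proof -
  define I where "I = {1..M * m}"
  have "0 < 16 / c\<^sup>2" using c by simp
  then have "M \<noteq> 0" using M by (intro notI) simp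
  then have "I \<noteq> {}" "finite I" using m(2) by (auto simp: I_def Suc_le_eq)
  \<comment> \<open>The least diameter, so that every set is thick at all radii up to
    \<open>R\<close>.\<close>
  define R where "R = Min ((\<lambda>i. diameter (E i)) ` I)"
  have "0 < R" "\<And>i. i \<in> I \<Longrightarrow> R \<le> diameter (E i)"
    using \<open>I \<noteq> {}\<close> \<open>finite I\<close> diam by (auto simp: R_def I_def)
  then interpret thick_family E I c R M m
    using assms \<open>finite I\<close> by unfold_locales (auto simp: I_def)
  \<comment> \<open>The empty set has diameter \<open>0\<close>.\<close>
  have "E i \<noteq> {}" if "i \<in> I" for i using diam[of i] that by (auto simp: I_def)
  then have "\<forall>i\<in>I. \<exists>x. x \<in> E i" by blast
  then obtain x where x: "\<forall>i\<in>I. x i \<in> E i" by metis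
  \<comment> \<open>Consecutive blocks of length \<open>M\<close>; the shift is there because
    indices start at 1.\<close>
  define s where "s i = (i - 1) div M" for i
  have "{i\<in>I. s i = t} = {t * M + 1..t * M + M}" if "t < m" for t
  proof -
    have le: "t * M + M \<le> M * m"
      using that by (metis Suc_leI mult_Suc_right mult_le_mono2 add.commute mult.commute)
    have s: "s i = t \<longleftrightarrow> t * M \<le> i - 1 \<and> i - 1 < t * M + M" for i
      unfolding s_def using \<open>M \<noteq> 0\<close>
      using dividend_less_div_times[of M "i - 1"] div_nat_eqI[of M t "i - 1"]
      by (auto simp: mult.commute add.commute)
    show ?thesis
    proof (intro set_eqI)
      fix i
      show "i \<in> {i\<in>I. s i = t} \<longleftrightarrow> i \<in> {t * M + 1..t * M + M}"
        unfolding mem_Collect_eq s I_def atLeastAtMost_iff using le \<open>M \<noteq> 0\<close> by linarith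
    qed
  qed
  moreover have "s ` I \<subseteq> {0..<m}"
    using \<open>M \<noteq> 0\<close> by (auto simp: s_def I_def less_mult_imp_div_less algebra_simps)
  ultimately have st: "staged 0 s" by (auto simp: staged_def)
  have "\<forall>i\<in>I. \<exists>u. cball u (c * rad (s i)) \<subseteq> convex hull (cball (x i) (rad (s i)) \<inter> E i)"
    using x centre_exists by blast
  then obtain y where
    "\<forall>i\<in>I. cball (y i) (c * rad (s i)) \<subseteq> convex hull (cball (x i) (rad (s i)) \<inter> E i)"
    by metis
  then have "centred s x y" using x by (simp add: centred_def)
  then have "cball (sum y I) (real M * c * R) \<subseteq> (\<Sum>i\<in>I. E i)"
    using cball_subset_set_sum st comp \<open>0 < m\<close> by (simp add: I_def)
  then have "ball (sum y I) (real M * c * R) \<subseteq> interior (\<Sum>i\<in>I. E i)"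
    by (intro interior_maximal) (use ball_subset_cball in auto)
  moreover have "sum y I \<in> ball (sum y I) (real M * c * R)"
    using \<open>M \<noteq> 0\<close> c \<open>0 < R\<close> by simp
  ultimately show ?thesis by (auto simp: I_def)
qed

theorem theorem1p2:
  fixes E :: "nat \<Rightarrow> (real ^ 'd) set" and n :: nat and c :: real
  assumes "\<And>i. i \<in> {1..n} \<Longrightarrow> compact (E i)"
    and "\<And>i. i \<in> {1..n} \<Longrightarrow> 0 < diameter (E i)"
    and "0 < c"
    and "\<And>i. i \<in> {1..n} \<Longrightarrow> c \<le> thickness (E i)"
    and "real n > 2 ^ 11 * c powi (-3) + 1"
  shows "interior (\<Sum>i\<in>{1..n}. E i) \<noteq> {}"
proof -
  have n: "2048 / c ^ 3 + 1 < real n"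
    using assms(5) by (simp add: power_int_minus divide_inverse)
  have "0 < 2048 / c ^ 3" using assms(3) by simp
  then have "1 < real n" using n by linarith
  then have "1 \<in> {1..n}" by simp
  then have "c \<le> 1"
    using assms(4)[of 1] thickness_greatest(1)[OF assms(1), of 1] by auto
  \<comment> \<open>The least integers with \<open>16 / c\<^sup>2 \<le> M\<close> and
    \<open>4 / c \<le> m\<close>; the latter gives \<open>4 / c \<le> 2 ^ m\<close> because
    \<open>m < 2 ^ m\<close>.\<close>
  define M where "M = nat \<lceil>16 / c\<^sup>2\<rceil>"
  define m where "m = nat \<lceil>4 / c\<rceil>"
  have c1: "1 \<le> 1 / c" "1 \<le> 1 / c\<^sup>2"
    using \<open>c \<le> 1\<close> assms(3) by (simp_all add: power_le_one)
  have M: "16 / c\<^sup>2 \<le> real M" by (simp add: M_def of_nat_ceiling)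
  have "real M \<le> 16 / c\<^sup>2 + 1" 
    using of_int_ceiling_le_add_one[of "16 / c\<^sup>2"] by (simp add: M_def)
  \<comment> \<open>As \<open>c \<le> 1\<close>, the 1 lost to the ceiling is at most
    \<open>1 / c\<^sup>2\<close>.\<close>
  then have M': "real M \<le> 17 / c\<^sup>2" using c1 by linarith
  have m: "4 / c \<le> real m" by (simp add: m_def of_nat_ceiling)
  have "real m \<le> 4 / c + 1"
    using of_int_ceiling_le_add_one[of "4 / c"] assms(3) by (simp add: m_def)
  then have m': "real m \<le> 5 / c" using c1 by linarith
  have "real M * real m \<le> 17 / c\<^sup>2 * (5 / c)"
    using M' m' assms(3) by (intro mult_mono) auto
  \<comment> \<open>So \<open>85 / c ^ 3\<close> bounds the number of sets in the scheme;
    \<open>interior_set_sum_superset\<close> adds the rest.\<close>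
  also have "\<dots> = 85 / c ^ 3" by (simp add: power2_eq_square power3_eq_cube)
  also have "\<dots> \<le> 2048 / c ^ 3" using assms(3) by (simp add: divide_right_mono)
  also have "\<dots> \<le> real n" using n by simp
  finally have "M * m \<le> n" by (metis of_nat_le_iff of_nat_mult)
  then have sub: "{1..M * m} \<subseteq> {1..n}" by simp
  have "interior (\<Sum>i\<in>{1..M * m}. E i) \<noteq> {}"
  proof (rule interior_sum_thick_sets)
    show "4 / c \<le> 2 ^ m" using m of_nat_less_two_power[of m, where 'a = real] by linarith
    show "0 < m" using m assms(3) by (cases "m = 0") (auto simp: field_simps)
  next
    fix i assume "i \<in> {1..M * m}"
    then have i: "i \<in> {1..n}" using sub by blast
    then show "compact (E i)" "0 < diameter (E i)" using assms by blast+
    show "thick_at_least (E i) c"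
      using thickness_greatest(2)[OF assms(1)[OF i]] assms(4)[OF i] thick_at_least_mono by blast
  qed (use assms(3) M in auto)
  moreover have "E i \<noteq> {}" if "i \<in> {1..n}" for i
    using assms(2)[OF that] by auto
  ultimately show ?thesis
    by (intro interior_set_sum_superset[OF _ sub]) auto
qed

end
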